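(* The intersection of fewer than $\mathfrak{g}$ groupwise dense subsets of $[\omega]^\omega$ is groupwise dense. Thus the family $B_{\mathcal M}^+$ of non-meager downward-closed subsets of $[\omega]^\omega$ is a $(<\mathfrak g)$-complete filter in the lattice $\mathcal M([\omega]^\omega)$.
   Context: $2^\omega$ carries the product topology (two-point discrete factors); meager means first category in this topology. Subsets of $\omega$ are identified with their characteristic functions, and $[\omega]^\omega \subseteq 2^\omega$ is the set of infinite subsets of $\omega$. For $x,y \subseteq \omega$, write $x \le y$ if $x - y$ is finite. A set $X \subseteq [\omega]^\omega$ is downward-closed if whenever $x \in X$, $y \in [\omega]^\omega$ and $y \le x$, then $y \in X$. $\mathcal M([\omega]^\omega)$ is the lattice of downward-closed subsets of $[\omega]^\omega$, ordered by inclusion. $B_{\mathcal M}$ is the family of meager members of $\mathcal M([\omega]^\omega)$, and $B_{\mathcal M}^+ = \mathcal M([\omega]^\omega) - B_{\mathcal M}$. A set $G \subseteq [\omega]^\omega$ is groupwise dense if it is downward-closed and, for every partition of $\omega$ into finite (nonempty) intervals, the union of some infinitely many of the intervals belongs to $G$. The cardinal $\mathfrak g$ is the smallest number of groupwise dense families whose intersection is empty. A filter in $\mathcal M([\omega]^\omega)$ is $(<\mathfrak g)$-complete if the intersection of any fewer than $\mathfrak g$ of its members is again a member. *)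

theory Defs
  imports "HOL-Analysis.Analysis" "HOL-Library.Disjoint_Sets"
begin

unbundle cardinal_syntax

text \<open>
  The Cantor space \<open>2\<^sup>\<omega>\<close> is the type \<^typ>\<open>nat \<Rightarrow> bool\<close>: the topology of the function type is the
  product topology, and \<^typ>\<open>bool\<close> is discrete.
\<close>

definition nowhere_dense :: "'a::topological_space set \<Rightarrow> bool" where
  "nowhere_dense A \<longleftrightarrow> interior (closure A) = {}"

definition meager :: "'a::topological_space set \<Rightarrow> bool" where
  "meager A \<longleftrightarrow> (\<exists>N :: nat \<Rightarrow> 'a set. (\<forall>n. nowhere_dense (N n)) \<and> A = (\<Union>n. N n))"

definition char_fun :: "nat set \<Rightarrow> nat \<Rightarrow> bool" where
  "char_fun x = (\<lambda>n. n \<in> x)"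

definition infinite_sets :: "nat set set" where
  "infinite_sets = {x. infinite x}"

definition almost_subset :: "nat set \<Rightarrow> nat set \<Rightarrow> bool" where
  "almost_subset x y \<longleftrightarrow> finite (x - y)"

definition downward_closed :: "nat set set \<Rightarrow> bool" where
  "downward_closed X \<longleftrightarrow>
     X \<subseteq> infinite_sets \<and>
     (\<forall>x\<in>X. \<forall>y\<in>infinite_sets. almost_subset y x \<longrightarrow> y \<in> X)"

definition downset_lattice :: "nat set set set" where
  "downset_lattice = {X. downward_closed X}"

definition meager_downsets :: "nat set set set" where
  "meager_downsets = {X \<in> downset_lattice. meager (char_fun ` X)}"

definition nonmeager_downsets :: "nat set set set" where
  "nonmeager_downsets = downset_lattice - meager_downsets"

definition interval_partition :: "nat set set \<Rightarrow> bool" where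
  "interval_partition P \<longleftrightarrow> partition_on UNIV P \<and> (\<forall>I\<in>P. \<exists>a b. I = {a..<b})"

definition groupwise_dense :: "nat set set \<Rightarrow> bool" where
  "groupwise_dense G \<longleftrightarrow>
     downward_closed G \<and>
     (\<forall>P. interval_partition P \<longrightarrow> (\<exists>J\<subseteq>P. infinite J \<and> \<Union>J \<in> G))"

text \<open>
  Intersections of families of subsets of \<^const>\<open>infinite_sets\<close> are taken inside
  \<^const>\<open>infinite_sets\<close>, so the empty family has intersection \<^const>\<open>infinite_sets\<close>,
  the top element of the lattice, and not \<^const>\<open>UNIV\<close>.
\<close>

definition family_Inter :: "nat set set set \<Rightarrow> nat set set" where
  "family_Inter \<X> = infinite_sets \<inter> \<Inter>\<X>"

definition gwd_empty_families :: "nat set set set set" where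
  "gwd_empty_families = {\<G>. (\<forall>G\<in>\<G>. groupwise_dense G) \<and> family_Inter \<G> = {}}"

text \<open>
  The cardinal \<open>\<gg>\<close>, as a well-order relation of least order type among the cardinals of the
  families above. Such families exist and the minimum is attained; see
  \<open>gwd_empty_families_nonempty\<close> and \<open>groupwise_density_number_least\<close> below.
\<close>

definition groupwise_density_number :: "nat set set rel" where
  "groupwise_density_number =
     (SOME r. r \<in> card_of ` gwd_empty_families \<and>
        (\<forall>\<G>\<in>gwd_empty_families. r \<le>o |\<G>| ))"

text \<open>
  A (proper) filter in a lattice \<open>L\<close> of sets ordered by inclusion and closed under binary
  intersections, which are then the meets of \<open>L\<close>.
\<close>

definition lattice_filter :: "'a set set \<Rightarrow> 'a set set \<Rightarrow> bool" where
  "lattice_filter L F \<longleftrightarrow>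
     F \<subseteq> L \<and> F \<noteq> {} \<and> F \<noteq> L \<and>
     (\<forall>X\<in>F. \<forall>Y\<in>L. X \<subseteq> Y \<longrightarrow> Y \<in> F) \<and>
     (\<forall>X\<in>F. \<forall>Y\<in>F. X \<inter> Y \<in> F)"

definition less_complete :: "'b rel \<Rightarrow> nat set set set \<Rightarrow> bool" where
  "less_complete r F \<longleftrightarrow> (\<forall>\<X>\<subseteq>F. |\<X>| <o r \<longrightarrow> family_Inter \<X> \<in> F)"

lemma downset_lattice_Int_Un:
  assumes "X \<in> downset_lattice" "Y \<in> downset_lattice"
  shows "X \<inter> Y \<in> downset_lattice" "X \<union> Y \<in> downset_lattice"
  using assms by (auto simp: downset_lattice_def downward_closed_def)

lemma groupwise_dense_not_almost_superset:
  assumes x: "infinite x"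
  shows "groupwise_dense {y \<in> infinite_sets. \<not> almost_subset x y}"
  unfolding groupwise_dense_def
proof (intro conjI allI impI)
  have "infinite (x - z)" if "infinite (x - y)" "finite (z - y)" for y z
  proof
    assume "finite (x - z)"
    then have "finite ((x - z) \<union> (z - y))" using that by simp
    then have "finite (x - y)" by (rule rev_finite_subset) auto
    then show False using that by simp
  qed
  then show "downward_closed {y \<in> infinite_sets. \<not> almost_subset x y}"
    by (auto simp: downward_closed_def almost_subset_def infinite_sets_def)
next
  fix P assume P: "interval_partition P"
  then have fin: "\<And>I. I \<in> P \<Longrightarrow> finite I" and un: "\<Union>P = UNIV"
    and disj: "\<And>I J. \<lbrakk>I \<in> P; J \<in> P; I \<noteq> J\<rbrakk> \<Longrightarrow> I \<inter> J = {}"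
    by (auto simp: interval_partition_def partition_on_def dest: disjointD)
  define Q where "Q = {I \<in> P. I \<inter> x \<noteq> {}}"
  have "x \<subseteq> \<Union>Q" using un by (auto simp: Q_def)
  then have "infinite Q"
    using x fin by (metis (no_types, lifting) Q_def finite_Union finite_subset mem_Collect_eq)
  then obtain f :: "nat \<Rightarrow> nat set" where f: "inj f" "range f \<subseteq> Q"
    using infinite_countable_subset by blast
  have "\<forall>n. \<exists>m. m \<in> f n \<inter> x" using f(2) by (auto simp: Q_def)
  then obtain c where c: "\<And>n. c n \<in> f n" "\<And>n. c n \<in> x" by (metis IntE)
  have fP: "f n \<in> P" for n using f(2) by (auto simp: Q_def)
  have fc: "c n \<in> f m \<longleftrightarrow> n = m" for n m
    using disj[OF fP fP, of n m] c(1)[of n] f(1) by (auto dest: injD)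
  have c_inj: "inj_on c S" for S
    by (rule inj_onI) (metis c(1) fc)
  define ev od where "ev = range (\<lambda>k::nat. 2 * k)" and "od = range (\<lambda>k::nat. 2 * k + 1)"
  have inf: "infinite ev" "infinite od"
    unfolding ev_def od_def by (rule range_inj_infinite; simp add: inj_def)+
  have eo: "n \<notin> ev" if "n \<in> od" for n
    using that unfolding ev_def od_def by (auto; presburger)
  have "infinite (f ` ev)"
    using inf(1) f(1) by (meson finite_imageD inj_on_subset subset_UNIV)
  moreover have "f ` ev \<subseteq> P" using fP by auto
  moreover have "infinite (\<Union>(f ` ev))"
  proof -
    have "infinite (c ` ev)" using inf(1) c_inj finite_imageD by blast
    moreover have "c ` ev \<subseteq> \<Union>(f ` ev)" using c(1) by auto
    ultimately show ?thesis using finite_subset by blast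
  qed
  moreover have "infinite (x - \<Union>(f ` ev))"
  proof -
    have "infinite (c ` od)" using inf(2) c_inj finite_imageD by blast
    moreover have "c ` od \<subseteq> x - \<Union>(f ` ev)" using c(2) eo by (auto simp: fc)
    ultimately show ?thesis using finite_subset by blast
  qed
  ultimately show "\<exists>J\<subseteq>P. infinite J \<and> \<Union>J \<in> {y \<in> infinite_sets. \<not> almost_subset x y}"
    by (intro exI[of _ "f ` ev"]) (auto simp: infinite_sets_def almost_subset_def)
qed

lemma gwd_empty_families_nonempty: "gwd_empty_families \<noteq> {}"
proof -
  define \<G> where "\<G> = (\<lambda>x. {y \<in> infinite_sets. \<not> almost_subset x y}) ` infinite_sets"
  have "\<forall>G\<in>\<G>. groupwise_dense G"
    using groupwise_dense_not_almost_superset by (auto simp: \<G>_def infinite_sets_def)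
  moreover have "family_Inter \<G> = {}"
    by (auto simp: \<G>_def family_Inter_def almost_subset_def) (metis Diff_cancel finite.emptyI)
  ultimately show ?thesis by (auto simp: gwd_empty_families_def)
qed

lemma groupwise_density_number_least:
  "groupwise_density_number \<in> card_of ` gwd_empty_families \<and>
   (\<forall>\<G>\<in>gwd_empty_families. groupwise_density_number \<le>o |\<G>| )"
  unfolding groupwise_density_number_def
proof (rule someI_ex)
  have "\<exists>r\<in>card_of ` gwd_empty_families. \<forall>r'\<in>card_of ` gwd_empty_families. r \<le>o r'"
    using gwd_empty_families_nonempty by (intro exists_minim_Card_order) (auto simp: card_of_Card_order)
  then show "\<exists>r. r \<in> card_of ` gwd_empty_families \<and> (\<forall>\<G>\<in>gwd_empty_families. r \<le>o |\<G>| )"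
    by blast
qed

end

theory Submission
  imports Defs
begin

text \<open>
  Fix an interval partition and let \<open>\<Union>x\<close> be the union of its blocks with index in \<open>x\<close>.
  For groupwise dense \<open>G\<close> the family of all \<open>x\<close> with \<open>\<Union>x \<in> G\<close> is again groupwise
  dense, because an interval partition of the indices gives a coarser partition of \<open>\<omega>\<close>.
  Fewer than \<open>\<gg>\<close> families of this kind share an \<open>x\<close>, and then \<open>\<Union>x\<close> lies in all the given families.

  A downward-closed family is groupwise dense iff it is non-meager. If it fails on a
  partition, each of its members contains only finitely many blocks, which is a meager condition. If
  it is covered by nowhere dense sets \<open>N\<^sub>i\<close>, there are a partition and a pattern on each
  block such that a set following the pattern on the \<open>n\<close>-th block avoids \<open>N\<^sub>0, \<dots>, N\<^sub>n\<close>. A set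
  that follows the patterns on infinitely many blocks and is empty elsewhere
  is not in the family, and neither is the union of these blocks.
\<close>

section \<open>Blocks of an increasing sequence\<close>

definition blocks :: "(nat \<Rightarrow> nat) \<Rightarrow> nat set \<Rightarrow> nat set" where
  "blocks b K = (\<Union>n\<in>K. {b n..<b (Suc n)})"

lemma blocks_index_unique:
  assumes "strict_mono b" "i \<in> {b n..<b (Suc n)}" "i \<in> {b m..<b (Suc m)}"
  shows "n = m"
proof (rule ccontr)
  assume "n \<noteq> m"
  then have "Suc n \<le> m \<or> Suc m \<le> n" by linarith
  then have "b (Suc n) \<le> b m \<or> b (Suc m) \<le> b n"
    using strict_mono_less_eq[OF assms(1)] by blast
  then show False using assms(2,3) by auto
qed

lemma infinite_blocks:
  assumes b: "strict_mono b" and K: "infinite K"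
  shows "infinite (blocks b K)"
proof -
  have "b ` K \<subseteq> blocks b K"
    using strict_monoD[OF b] by (auto simp: blocks_def)
  moreover have "infinite (b ` K)"
    using K strict_mono_imp_inj_on[OF b] by (meson finite_imageD inj_on_subset subset_UNIV)
  ultimately show ?thesis using finite_subset by blast
qed

lemma blocks_mono: "K \<subseteq> L \<Longrightarrow> blocks b K \<subseteq> blocks b L"
  by (auto simp: blocks_def)

lemma finite_blocks: "finite K \<Longrightarrow> finite (blocks b K)"
  by (simp add: blocks_def)

lemma ex_block:
  fixes b :: "nat \<Rightarrow> nat"
  assumes b: "strict_mono b" and le: "b k \<le> i"
  shows "\<exists>n\<ge>k. i \<in> {b n..<b (Suc n)}"
  using le
proof (induction i rule: dec_induct)
  case base
  show ?case using strict_monoD[OF b, of k "Suc k"] by auto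
next
  case (step i)
  then obtain n where n: "n \<ge> k" "b n \<le> i" "i < b (Suc n)" by auto
  show ?case
  proof (cases "Suc i < b (Suc n)")
    case True
    then show ?thesis using n by (intro exI[of _ n]) auto
  next
    case False
    then have "Suc i = b (Suc n)" using n by simp
    then show ?thesis using n strict_monoD[OF b, of "Suc n" "Suc (Suc n)"]
      by (intro exI[of _ "Suc n"]) auto
  qed
qed

text \<open>The \<open>m\<close>-th block of \<open>b \<circ> c\<close> is the union of the
  \<open>b\<close>-blocks with index in the \<open>m\<close>-th block of \<open>c\<close>. Hence a
  choice from a coarser partition is again a choice of \<open>b\<close>-blocks.\<close>

lemma blocks_comp:
  assumes b: "strict_mono b" and c: "strict_mono c"
  shows "blocks (b \<circ> c) K = blocks b (blocks c K)"
proof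
  show "blocks b (blocks c K) \<subseteq> blocks (b \<circ> c) K"
  proof
    fix i assume "i \<in> blocks b (blocks c K)"
    then obtain m n where mn: "m \<in> K" "c m \<le> n" "n < c (Suc m)" "b n \<le> i" "i < b (Suc n)"
      by (auto simp: blocks_def)
    then have "b (c m) \<le> b n" "b (Suc n) \<le> b (c (Suc m))"
      by (auto simp: strict_mono_less_eq[OF b] Suc_le_eq)
    then show "i \<in> blocks (b \<circ> c) K"
      using mn by (auto simp: blocks_def intro!: bexI[of _ m])
  qed
next
  show "blocks (b \<circ> c) K \<subseteq> blocks b (blocks c K)"
  proof
    fix i assume "i \<in> blocks (b \<circ> c) K"
    then obtain m where m: "m \<in> K" "b (c m) \<le> i" "i < b (c (Suc m))"
      by (auto simp: blocks_def)
    then obtain n where n: "n \<ge> c m" "i \<in> {b n..<b (Suc n)}"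
      using ex_block[OF b] by blast
    then have "b n < b (c (Suc m))" using m by auto
    then have "n < c (Suc m)" by (simp add: strict_mono_less[OF b])
    then have "n \<in> blocks c K" using m n by (auto simp: blocks_def)
    then show "i \<in> blocks b (blocks c K)" using n(2) unfolding blocks_def[of b] by blast
  qed
qed

lemma interval_partition_blocks:
  assumes b: "strict_mono b" and b0: "b 0 = 0"
  shows "interval_partition (range (\<lambda>n. {b n..<b (Suc n)}))"
  unfolding interval_partition_def partition_on_def
proof (intro conjI ballI)
  have "i \<in> \<Union>(range (\<lambda>n. {b n..<b (Suc n)}))" for i
    using ex_block[OF b, of 0 i] b0 by auto
  then show "\<Union>(range (\<lambda>n. {b n..<b (Suc n)})) = UNIV" by blast
  show "disjoint (range (\<lambda>n. {b n..<b (Suc n)}))"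
  proof (rule disjointI)
    fix I J
    assume "I \<in> range (\<lambda>n. {b n..<b (Suc n)})" "J \<in> range (\<lambda>n. {b n..<b (Suc n)})" "I \<noteq> J"
    then obtain n m where nm: "I = {b n..<b (Suc n)}" "J = {b m..<b (Suc m)}" "n \<noteq> m" by blast
    then show "I \<inter> J = {}" using blocks_index_unique[OF b, of _ n m] by blast
  qed
  show "{} \<notin> range (\<lambda>n. {b n..<b (Suc n)})"
  proof
    assume "{} \<in> range (\<lambda>n. {b n..<b (Suc n)})"
    then obtain n where "{} = {b n..<b (Suc n)}" by (rule rangeE)
    then have "b n \<notin> {b n..<b (Suc n)}" by blast
    then show False using strict_monoD[OF b, of n "Suc n"] by simp
  qed
  fix I assume "I \<in> range (\<lambda>n. {b n..<b (Suc n)})"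
  then show "\<exists>c d. I = {c..<d}" by blast
qed

text \<open>Start at 0 and repeatedly jump to the right end of the current interval. By disjointness
  the interval containing that point must begin there.\<close>

lemma interval_partition_obtain_blocks:
  assumes P: "interval_partition P"
  obtains b where "strict_mono b" "\<And>n. {b n..<b (Suc n)} \<in> P"
proof -
  have int: "\<And>I. I \<in> P \<Longrightarrow> \<exists>a b. I = {a..<b}"
    using P by (simp add: interval_partition_def)
  have part: "partition_on UNIV P" using P by (simp add: interval_partition_def)
  have un: "\<Union>P = UNIV" using partition_onD1[OF part] by simp
  have disj: "I \<inter> J = {}" if "I \<in> P" "J \<in> P" "I \<noteq> J" for I J
    using disjointD[OF partition_onD2[OF part] that] .
  have "\<exists>a e. a \<le> m \<and> m < e \<and> {a..<e} \<in> P" for m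
  proof -
    obtain I where "I \<in> P" "m \<in> I" using un by (metis UNIV_I UnionE)
    moreover obtain a e where "I = {a..<e}" using int \<open>I \<in> P\<close> by blast
    ultimately show ?thesis by (metis atLeastLessThan_iff)
  qed
  then obtain a e where ae: "\<And>m. a m \<le> m" "\<And>m. m < e m" "\<And>m. {a m..<e m} \<in> P"
    by metis
  define b where "b n = (e ^^ n) 0" for n
  have b_Suc: "b (Suc n) = e (b n)" for n by (simp add: b_def)
  have left: "a (b n) = b n" for n
  proof (induction n)
    case 0
    show ?case using ae(1)[of 0] by (simp add: b_def)
  next
    case (Suc n)
    let ?m = "b n"
    have "{a ?m..<e ?m} \<noteq> {a (e ?m)..<e (e ?m)}"
      using ae(1,2)[of "e ?m"] by (metis atLeastLessThan_iff less_irrefl)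
    then have "{a ?m..<e ?m} \<inter> {a (e ?m)..<e (e ?m)} = {}"
      using disj ae(3) by blast
    \<comment> \<open>The last point of the old interval is not in the new one, so the new one
      cannot start before \<open>e ?m\<close>.\<close>
    then have "e ?m - 1 \<notin> {a (e ?m)..<e (e ?m)}"
      using ae(1,2)[of ?m] by fastforce
    then show ?case using ae(1,2)[of "e ?m"] ae(2)[of ?m] b_Suc[of n] by auto
  qed
  show thesis
  proof (rule that)
    show "strict_mono b" using ae(2) by (simp add: strict_mono_Suc_iff b_Suc)
    show "{b n..<b (Suc n)} \<in> P" for n using ae(3)[of "b n"] left b_Suc by simp
  qed
qed

section \<open>Groupwise density in terms of block sequences\<close>

lemma downward_closed_subset:
  assumes "downward_closed X" "x \<in> X" "y \<subseteq> x" "infinite y"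
  shows "y \<in> X"
proof -
  have "y - x = {}" using assms(3) by blast
  then show ?thesis
    using assms unfolding downward_closed_def almost_subset_def infinite_sets_def
    by (metis finite.emptyI mem_Collect_eq)
qed

lemma groupwise_dense_downward_closed: "groupwise_dense G \<Longrightarrow> downward_closed G"
  by (simp add: groupwise_dense_def)

lemma groupwise_dense_iff_blocks:
  "groupwise_dense G \<longleftrightarrow>
     downward_closed G \<and> (\<forall>b. strict_mono b \<longrightarrow> (\<exists>K. infinite K \<and> blocks b K \<in> G))"
  (is "?L \<longleftrightarrow> ?R")
proof
  assume L: ?L
  then have dc: "downward_closed G" by (rule groupwise_dense_downward_closed)
  show ?R
  proof (intro conjI dc allI impI)
    fix b :: "nat \<Rightarrow> nat" assume b: "strict_mono b"
    \<comment> \<open>The sequence \<open>b\<close> need not start at \<open>0\<close>, so its first block is enlarged.\<close>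
    define b' where "b' = b(0 := 0)"
    have b': "strict_mono b'"
      unfolding strict_mono_Suc_iff
    proof
      fix n
      show "b' n < b' (Suc n)" using strict_monoD[OF b, of n "Suc n"] by (cases n) (auto simp: b'_def)
    qed
    define I where "I n = {b' n..<b' (Suc n)}" for n
    have sub: "{b n..<b (Suc n)} \<subseteq> I n" for n by (auto simp: I_def b'_def)
    have "interval_partition (range I)"
      unfolding I_def by (rule interval_partition_blocks[OF b']) (simp add: b'_def)
    then obtain J where J: "J \<subseteq> range I" "infinite J" "\<Union>J \<in> G"
      using L by (auto simp: groupwise_dense_def)
    define K where "K = {n. I n \<in> J}"
    have "J \<subseteq> I ` K" using J(1) by (auto simp: K_def)
    then have K: "infinite K" using J(2) finite_surj by blast
    \<comment> \<open>Each \<open>b\<close>-block lies inside the possibly enlarged block, so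
      downward closure leads back from \<open>b'\<close> to \<open>b\<close>.\<close>
    moreover have "blocks b K \<subseteq> \<Union>J" using sub by (fastforce simp: blocks_def K_def)
    ultimately show "\<exists>K. infinite K \<and> blocks b K \<in> G"
      using downward_closed_subset[OF dc J(3)] infinite_blocks[OF b] by blast
  qed
next
  assume R: ?R
  show ?L unfolding groupwise_dense_def
  proof (intro conjI allI impI)
    show "downward_closed G" using R by simp
    fix P assume "interval_partition P"
    then obtain b where b: "strict_mono b" "\<And>n. {b n..<b (Suc n)} \<in> P"
      using interval_partition_obtain_blocks by blast
    obtain K where K: "infinite K" "blocks b K \<in> G" using R b(1) by blast
    have "inj_on (\<lambda>n. {b n..<b (Suc n)}) K"
    proof (rule inj_onI)
      fix n m assume eq: "{b n..<b (Suc n)} = {b m..<b (Suc m)}"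
      have "b n \<in> {b n..<b (Suc n)}" using strict_monoD[OF b(1)] by simp
      then show "n = m" using eq blocks_index_unique[OF b(1)] by metis
    qed
    then have "infinite ((\<lambda>n. {b n..<b (Suc n)}) ` K)" using K(1) finite_imageD by blast
    moreover have "(\<lambda>n. {b n..<b (Suc n)}) ` K \<subseteq> P" using b(2) by blast
    ultimately show "\<exists>J\<subseteq>P. infinite J \<and> \<Union>J \<in> G"
      using K(2) unfolding blocks_def by blast
  qed
qed

lemma groupwise_dense_obtain_blocks:
  assumes "groupwise_dense G" "strict_mono b"
  obtains K where "infinite K" "blocks b K \<in> G"
proof -
  have "\<forall>b. strict_mono b \<longrightarrow> (\<exists>K. infinite K \<and> blocks b K \<in> G)"
    using assms(1) unfolding groupwise_dense_iff_blocks by (rule conjunct2)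
  then obtain K where "infinite K" "blocks b K \<in> G" using assms(2) by metis
  then show thesis by (rule that)
qed

section \<open>Intersections of groupwise dense families\<close>

lemma downward_closed_family_Inter:
  assumes "\<And>G. G \<in> \<G> \<Longrightarrow> downward_closed G"
  shows "downward_closed (family_Inter \<G>)"
  unfolding downward_closed_def
proof (intro conjI ballI impI)
  show "family_Inter \<G> \<subseteq> infinite_sets" by (simp add: family_Inter_def)
  fix x y assume xy: "x \<in> family_Inter \<G>" "y \<in> infinite_sets" "almost_subset y x"
  have "y \<in> G" if G: "G \<in> \<G>" for G
  proof -
    have "x \<in> G" using xy(1) G by (simp add: family_Inter_def)
    then show ?thesis using assms[OF G] xy(2,3) by (simp add: downward_closed_def)
  qed
  then show "y \<in> family_Inter \<G>" using xy(2) by (simp add: family_Inter_def)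
qed

text \<open>Given cut points \<open>c\<close> for the indices, the density of \<open>G\<close> is
  applied to the coarser sequence \<open>b \<circ> c\<close>.\<close>

lemma groupwise_dense_preimage_blocks:
  assumes G: "groupwise_dense G" and b: "strict_mono b"
  shows "groupwise_dense {x \<in> infinite_sets. blocks b x \<in> G}"
  unfolding groupwise_dense_iff_blocks
proof (intro conjI allI impI)
  have dc: "downward_closed G" using G by (rule groupwise_dense_downward_closed)
  have "blocks b y \<in> G" if "blocks b x \<in> G" "infinite y" "finite (y - x)" for x y
  proof -
    \<comment> \<open>Since each block is finite, almost inclusion of index sets passes to the
      unions of blocks.\<close>
    have "blocks b y - blocks b x \<subseteq> blocks b (y - x)" by (auto simp: blocks_def)
    then have "finite (blocks b y - blocks b x)"
      using finite_blocks[OF that(3)] finite_subset by blast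
    then show ?thesis
      using dc that infinite_blocks[OF b]
      by (auto simp: downward_closed_def almost_subset_def infinite_sets_def)
  qed
  then show "downward_closed {x \<in> infinite_sets. blocks b x \<in> G}"
    by (auto simp: downward_closed_def almost_subset_def infinite_sets_def)
  fix c :: "nat \<Rightarrow> nat" assume c: "strict_mono c"
  obtain K where "infinite K" "blocks (b \<circ> c) K \<in> G"
    using groupwise_dense_obtain_blocks[OF G strict_mono_o[OF b c]] .
  then show "\<exists>K. infinite K \<and> blocks c K \<in> {x \<in> infinite_sets. blocks b x \<in> G}"
    using infinite_blocks[OF c] blocks_comp[OF b c] by (auto simp: infinite_sets_def)
qed

text \<open>For fixed \<open>b\<close> the preimages form a family no larger than
  \<open>\<G>\<close>, so by minimality of the cardinal their intersection is nonempty. Any common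
  element is one index set that works for all of \<open>\<G>\<close>.\<close>

lemma groupwise_dense_family_Inter:
  assumes gd: "\<forall>G\<in>\<G>. groupwise_dense G" and less: "|\<G>| <o groupwise_density_number"
  shows "groupwise_dense (family_Inter \<G>)"
  unfolding groupwise_dense_iff_blocks
proof (intro conjI allI impI)
  show "downward_closed (family_Inter \<G>)"
    using gd by (intro downward_closed_family_Inter groupwise_dense_downward_closed) blast
  fix b :: "nat \<Rightarrow> nat" assume b: "strict_mono b"
  let ?pre = "\<lambda>G. {x \<in> infinite_sets. blocks b x \<in> G}"
  have "|?pre ` \<G>| <o groupwise_density_number"
    using card_of_image less by (rule ordLeq_ordLess_trans)
  then have "?pre ` \<G> \<notin> gwd_empty_families"
    using groupwise_density_number_least not_ordLess_ordLeq by blast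
  moreover have "\<forall>G\<in>?pre ` \<G>. groupwise_dense G"
    using gd groupwise_dense_preimage_blocks[OF _ b] by blast
  ultimately obtain x where "x \<in> family_Inter (?pre ` \<G>)"
    by (auto simp: gwd_empty_families_def)
  then have "infinite x" "\<And>G. G \<in> \<G> \<Longrightarrow> blocks b x \<in> G"
    by (auto simp: family_Inter_def infinite_sets_def)
  then show "\<exists>K. infinite K \<and> blocks b K \<in> family_Inter \<G>"
    using infinite_blocks[OF b] by (auto simp: family_Inter_def infinite_sets_def)
qed

text \<open>A direct argument for two families, which avoids showing first that
  \<open>groupwise_density_number\<close> exceeds 2: the blocks are thinned for \<open>X\<close>,
  and the thinned sequence is then coarsened for \<open>Y\<close>.\<close>

lemma groupwise_dense_Int:
  assumes X: "groupwise_dense X" and Y: "groupwise_dense Y"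
  shows "groupwise_dense (X \<inter> Y)"
  unfolding groupwise_dense_iff_blocks
proof (intro conjI allI impI)
  note dc = X[THEN groupwise_dense_downward_closed] Y[THEN groupwise_dense_downward_closed]
  then show "downward_closed (X \<inter> Y)" unfolding downward_closed_def by blast
  fix b :: "nat \<Rightarrow> nat" assume b: "strict_mono b"
  obtain K where K: "infinite K" "blocks b K \<in> X"
    using groupwise_dense_obtain_blocks[OF X b] .
  let ?c = "enumerate K"
  \<comment> \<open>With these cut points every block of \<open>b \<circ> ?c\<close> starts with a
    \<open>b\<close>-block whose index is in \<open>K\<close>. Keeping only these first
    \<open>b\<close>-blocks, for indices in \<open>L\<close>, gives a subset of both chosen
    unions.\<close>
  have c: "strict_mono ?c" using K(1) by (rule strict_mono_enumerate)
  obtain L where L: "infinite L" "blocks (b \<circ> ?c) L \<in> Y"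
    using groupwise_dense_obtain_blocks[OF Y strict_mono_o[OF b c]] .
  have inf: "infinite (?c ` L)"
    using L(1) strict_mono_imp_inj_on[OF c] by (meson finite_imageD inj_on_subset subset_UNIV)
  have "?c ` L \<subseteq> K" using K(1) enumerate_in_set by blast
  then have "blocks b (?c ` L) \<in> X"
    using downward_closed_subset[OF dc(1) K(2)] blocks_mono infinite_blocks[OF b inf] by blast
  moreover have "?c ` L \<subseteq> blocks ?c L"
    using strict_monoD[OF c] by (auto simp: blocks_def)
  then have "blocks b (?c ` L) \<in> Y"
    using downward_closed_subset[OF dc(2) L(2)] blocks_mono infinite_blocks[OF b inf]
    unfolding blocks_comp[OF b c] by blast
  ultimately show "\<exists>K. infinite K \<and> blocks b K \<in> X \<inter> Y" using inf by blast
qed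

section \<open>Groupwise dense and non-meager families\<close>

lemma open_cylinder: "open {y :: nat \<Rightarrow> bool. \<forall>i<k. y i = x i}"
proof -
  have "open {y :: nat \<Rightarrow> bool. \<forall>i\<in>{..<k}. y i \<in> {x i}}"
    by (rule product_topology_basis') (auto intro: open_discrete)
  then show ?thesis by (simp add: Ball_def)
qed

lemma open_contains_cylinder:
  fixes U :: "(nat \<Rightarrow> bool) set"
  assumes U: "open U" and x: "x \<in> U"
  obtains k where "\<And>y. (\<And>i. i < k \<Longrightarrow> y i = x i) \<Longrightarrow> y \<in> U"
proof -
  obtain V where V: "x \<in> Pi\<^sub>E UNIV V" "finite {i. V i \<noteq> UNIV}" "Pi\<^sub>E UNIV V \<subseteq> U"
    using product_topology_open_contains_basis[of "\<lambda>i. euclidean" UNIV U x] U x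
    by (auto simp: open_fun_def)
  obtain k where k: "\<And>i. V i \<noteq> UNIV \<Longrightarrow> i < k"
    using V(2) unfolding finite_nat_set_iff_bounded by blast
  show thesis
  proof (rule that[of k])
    fix y assume y: "\<And>i. i < k \<Longrightarrow> y i = x i"
    have "y i \<in> V i" for i
      using k[of i] y[of i] V(1) by (cases "V i = UNIV") (auto simp: PiE_def Pi_def)
    then show "y \<in> U" using V(3) by auto
  qed
qed

text \<open>The cylinder of \<open>x\<close> below \<open>m\<close> is open and nonempty, so it has
  a point outside \<open>closure N\<close>. Some cylinder around that point misses
  \<open>N\<close>.\<close>

lemma nowhere_dense_cylinder:
  fixes N :: "(nat \<Rightarrow> bool) set"
  assumes "nowhere_dense N"
  obtains k w where "k \<ge> m" "\<forall>i<m. w i = x i" "\<forall>y. (\<forall>i<k. y i = w i) \<longrightarrow> y \<notin> N"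
proof -
  let ?C = "{y. \<forall>i<m. y i = x i}"
  have "\<not> ?C \<subseteq> closure N"
  proof
    assume "?C \<subseteq> closure N"
    then have "?C \<subseteq> interior (closure N)" using open_cylinder by (rule interior_maximal)
    then show False using assms by (auto simp: nowhere_dense_def)
  qed
  then obtain w where w: "\<forall>i<m. w i = x i" "w \<in> - closure N" by auto
  obtain k where k: "\<And>y. (\<And>i. i < k \<Longrightarrow> y i = w i) \<Longrightarrow> y \<in> - closure N"
    using open_contains_cylinder[OF open_Compl[OF closed_closure] w(2)] by blast
  show thesis
  proof (rule that)
    show "\<forall>i<m. w i = x i" by (rule w(1))
    show "\<forall>y. (\<forall>i<max m k. y i = w i) \<longrightarrow> y \<notin> N"
    proof (intro allI impI)
      fix y assume "\<forall>i<max m k. y i = w i"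
      then have "y \<in> - closure N" by (intro k) simp
      then show "y \<notin> N" using closure_subset[of N] by blast
    qed
  qed simp
qed

text \<open>The pairs are treated one after another, each time prolonging the pattern; a longer
  pattern keeps what a shorter one has achieved. The demand \<open>s m\<close> later makes a set
  that follows infinitely many patterns infinite.\<close>

lemma nowhere_dense_pattern_finite:
  fixes T :: "((nat \<Rightarrow> bool) \<times> (nat \<Rightarrow> bool) set) set"
  assumes "finite T" "\<And>t N. (t, N) \<in> T \<Longrightarrow> nowhere_dense N"
  shows "\<exists>k>m. \<exists>s. s m \<and> (\<forall>t N y. (t, N) \<in> T \<longrightarrow>
           (\<forall>i<m. y i = t i) \<longrightarrow> (\<forall>i\<in>{m..<k}. y i = s i) \<longrightarrow> y \<notin> N)"
  using assms
proof (induction T rule: finite_induct)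
  case empty
  show ?case by (intro exI[of _ "Suc m"] conjI exI[of _ "\<lambda>_. True"]) auto
next
  case (insert p T)
  obtain t N where p: "p = (t, N)" by (cases p)
  obtain k s where ks: "k > m" "s m"
    "\<And>t N y. \<lbrakk>(t, N) \<in> T; \<forall>i<m. y i = t i; \<forall>i\<in>{m..<k}. y i = s i\<rbrakk> \<Longrightarrow> y \<notin> N"
  proof -
    have "\<exists>k>m. \<exists>s. s m \<and> (\<forall>t N y. (t, N) \<in> T \<longrightarrow>
        (\<forall>i<m. y i = t i) \<longrightarrow> (\<forall>i\<in>{m..<k}. y i = s i) \<longrightarrow> y \<notin> N)"
      by (rule insert.IH) (use insert.prems in blast)
    then show thesis using that by blast
  qed
  have N: "nowhere_dense N" using insert.prems[of t N] p by simp
  \<comment> \<open>The string to be prolonged is \<open>t\<close> below \<open>m\<close> followed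
    by the pattern found so far.\<close>
  obtain w l where wl: "l \<ge> k" "\<forall>i<k. w i = (if i < m then t i else s i)"
    "\<forall>y. (\<forall>i<l. y i = w i) \<longrightarrow> y \<notin> N"
    using nowhere_dense_cylinder[OF N, of k "\<lambda>i. if i < m then t i else s i"] .
  have "y \<notin> N'" if "(t', N') \<in> insert p T" "\<forall>i<m. y i = t' i" "\<forall>i\<in>{m..<l}. y i = w i" for t' N' y
  proof (cases "(t', N') \<in> T")
    case True
    have "\<forall>i\<in>{m..<k}. y i = s i" using that(3) wl(1,2) by auto
    then show ?thesis using ks(3)[OF True that(2)] by blast
  next
    case False
    then have eq: "t' = t" "N' = N" using that(1) p by auto
    have "y i = w i" if "i < l" for i
      using that \<open>\<forall>i<m. y i = t' i\<close> \<open>\<forall>i\<in>{m..<l}. y i = w i\<close> wl(2) ks(1) eq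
      by (cases "i < m") auto
    then show ?thesis using wl(3) eq by blast
  qed
  moreover have "l > m" "w m" using ks wl by auto
  ultimately show ?case by blast
qed

lemma nowhere_dense_pattern:
  fixes N :: "nat \<Rightarrow> (nat \<Rightarrow> bool) set"
  assumes "\<And>n. nowhere_dense (N n)"
  shows "\<exists>k s. k > m \<and> s m \<and> (\<forall>y. (\<forall>i\<in>{m..<k}. y i = s i) \<longrightarrow> (\<forall>j\<le>n. y \<notin> N j))"
proof -
  \<comment> \<open>The first factor lists all initial segments of length \<open>m\<close>,
    continued by \<open>False\<close>. Whatever \<open>y\<close> does below \<open>m\<close> is
    therefore covered by some pair.\<close>
  define T where "T = char_fun ` Pow {..<m} \<times> N ` {..n}"
  have T: "finite T" "\<And>t M. (t, M) \<in> T \<Longrightarrow> nowhere_dense M"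
    using assms by (auto simp: T_def)
  obtain k s where ks: "k > m" "s m"
    and avoid: "\<forall>t M y. (t, M) \<in> T \<longrightarrow>
      (\<forall>i<m. y i = t i) \<longrightarrow> (\<forall>i\<in>{m..<k}. y i = s i) \<longrightarrow> y \<notin> M"
  proof -
    have "\<exists>k>m. \<exists>s. s m \<and> (\<forall>t M y. (t, M) \<in> T \<longrightarrow>
        (\<forall>i<m. y i = t i) \<longrightarrow> (\<forall>i\<in>{m..<k}. y i = s i) \<longrightarrow> y \<notin> M)"
      by (rule nowhere_dense_pattern_finite[OF T(1)]) (rule T(2))
    then show thesis using that by blast
  qed
  have "y \<notin> N j" if y: "\<forall>i\<in>{m..<k}. y i = s i" and j: "j \<le> n" for y j
  proof -
    have mem: "(char_fun {i. i < m \<and> y i}, N j) \<in> T" using j by (auto simp: T_def)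
    have below: "\<forall>i<m. y i = char_fun {i. i < m \<and> y i} i" by (simp add: char_fun_def)
    show ?thesis
      using avoid[THEN spec, THEN spec, THEN spec, THEN mp, OF mem, THEN mp, OF below, THEN mp, OF y] .
  qed
  then show ?thesis using ks by blast
qed

text \<open>From a cover by nowhere dense sets, blocks and patterns are built so that some member of
  \<open>G\<close> follows infinitely many of the patterns and thereby escapes every set of the
  cover.\<close>

lemma groupwise_dense_imp_not_meager:
  assumes G: "groupwise_dense G"
  shows "\<not> meager (char_fun ` G)"
proof
  assume "meager (char_fun ` G)"
  then obtain N where N: "\<And>n::nat. nowhere_dense (N n)" "char_fun ` G = (\<Union>n. N n)"
    unfolding meager_def by blast
  \<comment> \<open>\<open>e n m\<close> and \<open>s n m\<close> are the right end and the pattern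
    of the \<open>n\<close>-th block in case it starts at \<open>m\<close>. Choosing them for all
    \<open>m\<close> lets the recursion for \<open>b\<close> follow afterwards.\<close>
  obtain e s where es: "\<And>n m. e n m > m" "\<And>n m. s n m m"
    "\<And>n m y j. \<lbrakk>\<forall>i\<in>{m..<e n m}. y i = s n m i; j \<le> n\<rbrakk> \<Longrightarrow> y \<notin> N j"
  proof -
    define Q where "Q n m k s \<longleftrightarrow>
      k > m \<and> s m \<and> (\<forall>y. (\<forall>i\<in>{m..<k}. y i = s i) \<longrightarrow> (\<forall>j\<le>n. y \<notin> N j))" for n m k s
    have "\<forall>n m. \<exists>k s. Q n m k s"
      unfolding Q_def by (intro allI nowhere_dense_pattern N(1))
    then obtain e s where "\<And>n m. Q n m (e n m) (s n m)" by metis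
    then show thesis by (intro that[of e s]) (auto simp: Q_def)
  qed
  define b where "b = rec_nat 0 e"
  have b_Suc: "b (Suc n) = e n (b n)" for n by (simp add: b_def)
  have b: "strict_mono b" using es(1) by (simp add: strict_mono_Suc_iff b_Suc)
  obtain K where K: "infinite K" "blocks b K \<in> G"
    using groupwise_dense_obtain_blocks[OF G b] .
  \<comment> \<open>\<open>z\<close> copies the patterns on the blocks in \<open>K\<close> and is
    empty elsewhere. It contains each \<open>b n\<close> with \<open>n\<close> in \<open>K\<close>,
    so it is infinite and downward closure applies.\<close>
  define z where "z = {i. \<exists>n\<in>K. i \<in> {b n..<b (Suc n)} \<and> s n (b n) i}"
  have "b ` K \<subseteq> z" using es(2) strict_monoD[OF b] by (auto simp: z_def)
  moreover have "infinite (b ` K)"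
    using K(1) strict_mono_imp_inj_on[OF b] by (meson finite_imageD inj_on_subset subset_UNIV)
  ultimately have "infinite z" using finite_subset by blast
  moreover have "z \<subseteq> blocks b K" by (auto simp: z_def blocks_def)
  ultimately have "z \<in> G"
    using downward_closed_subset[OF groupwise_dense_downward_closed[OF G] K(2)] by blast
  then obtain j where j: "char_fun z \<in> N j" using N(2) by blast
  \<comment> \<open>Some chosen block comes late enough for its pattern to avoid
    \<open>N j\<close>.\<close>
  obtain n where n: "n \<in> K" "n \<ge> j" using K(1) by (meson infinite_nat_iff_unbounded_le)
  have "\<forall>i\<in>{b n..<e n (b n)}. char_fun z i = s n (b n) i"
  proof
    fix i assume "i \<in> {b n..<e n (b n)}"
    then have i: "i \<in> {b n..<b (Suc n)}" by (simp add: b_Suc)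
    have "i \<in> z \<longleftrightarrow> s n (b n) i"
    proof
      assume "i \<in> z"
      then obtain m where m: "i \<in> {b m..<b (Suc m)}" "s m (b m) i" by (auto simp: z_def)
      have "n = m" using b i m(1) by (rule blocks_index_unique)
      then show "s n (b n) i" using m(2) by simp
    next
      assume "s n (b n) i"
      then show "i \<in> z" using n(1) i unfolding z_def by blast
    qed
    then show "char_fun z i = s n (b n) i" by (simp add: char_fun_def)
  qed
  from es(3)[OF this n(2)] j show False by contradiction
qed

text \<open>Containing a full block depends on finitely many coordinates, so the set is closed. Its
  interior is empty because any initial segment can be continued by \<open>True\<close>.\<close>

lemma nowhere_dense_no_late_block:
  assumes b: "strict_mono b"
  shows "nowhere_dense {y :: nat \<Rightarrow> bool. \<forall>n\<ge>m. \<exists>i\<in>{b n..<b (Suc n)}. \<not> y i}"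
    (is "nowhere_dense ?A")
proof -
  have "open (- ?A)"
  proof (subst open_subopen, intro ballI)
    fix y assume "y \<in> - ?A"
    then obtain n where "n \<ge> m" "\<forall>i\<in>{b n..<b (Suc n)}. y i" by auto
    then have "{z. \<forall>i<b (Suc n). z i = y i} \<subseteq> - ?A" by auto
    then show "\<exists>T. open T \<and> y \<in> T \<and> T \<subseteq> - ?A"
      using open_cylinder by (intro exI[of _ "{z. \<forall>i<b (Suc n). z i = y i}"]) auto
  qed
  then have closed: "closure ?A = ?A" by (simp add: closed_def)
  have "interior ?A = {}"
  proof (rule ccontr)
    assume "interior ?A \<noteq> {}"
    then obtain x where "x \<in> interior ?A" by blast
    then obtain k where k: "\<And>y. (\<And>i. i < k \<Longrightarrow> y i = x i) \<Longrightarrow> y \<in> interior ?A"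
      using open_contains_cylinder[OF open_interior] by blast
    define y where "y i = (if i < k then x i else True)" for i
    have "y \<in> interior ?A" by (rule k) (simp add: y_def)
    then have "y \<in> ?A" by (rule subsetD[OF interior_subset])
    then have "\<exists>i\<in>{b (max m k)..<b (Suc (max m k))}. \<not> y i"
      using max.cobounded1[of m k] by blast
    \<comment> \<open>As \<open>b n \<ge> n\<close>, this block lies entirely in the part where
      \<open>y\<close> is \<open>True\<close>.\<close>
    moreover have "max m k \<le> b (max m k)" using b by (rule strict_mono_imp_increasing)
    then have "\<forall>i\<in>{b (max m k)..<b (Suc (max m k))}. y i" by (auto simp: y_def)
    ultimately show False by blast
  qed
  then show ?thesis by (simp add: nowhere_dense_def closed)
qed

lemma nowhere_dense_subset: "nowhere_dense B \<Longrightarrow> A \<subseteq> B \<Longrightarrow> nowhere_dense A"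
  unfolding nowhere_dense_def by (metis closure_mono interior_mono subset_empty)

text \<open>\<open>meager\<close> asks for equality with the union, so the covering sets are cut
  down to \<open>A\<close>.\<close>

lemma meager_subset:
  assumes "meager B" "A \<subseteq> B"
  shows "meager A"
proof -
  obtain N where N: "\<And>n::nat. nowhere_dense (N n)" "B = (\<Union>n. N n)"
    using assms(1) unfolding meager_def by blast
  show ?thesis unfolding meager_def
  proof (intro exI conjI allI)
    show "nowhere_dense (N n \<inter> A)" for n using N(1) nowhere_dense_subset by blast
    show "A = (\<Union>n. N n \<inter> A)" using assms(2) N(2) by blast
  qed
qed

text \<open>If \<open>b\<close> witnesses failure, no member of \<open>X\<close> contains infinitely
  many blocks, since downward closure would put their union into \<open>X\<close>. Hence each member
  lies in one of countably many nowhere dense sets, according to where its full blocks end.\<close>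

lemma not_meager_imp_groupwise_dense:
  assumes dc: "downward_closed X" and nm: "\<not> meager (char_fun ` X)"
  shows "groupwise_dense X"
proof (rule ccontr)
  assume "\<not> groupwise_dense X"
  then obtain b where b: "strict_mono b" "\<And>K. infinite K \<Longrightarrow> blocks b K \<notin> X"
    using dc unfolding groupwise_dense_iff_blocks by blast
  define A where "A m = {y :: nat \<Rightarrow> bool. \<forall>n\<ge>m. \<exists>i\<in>{b n..<b (Suc n)}. \<not> y i}" for m
  have "char_fun ` X \<subseteq> (\<Union>m. A m)"
  proof (rule image_subsetI)
    fix x assume x: "x \<in> X"
    define K where "K = {n. {b n..<b (Suc n)} \<subseteq> x}"
    have "blocks b K \<subseteq> x" by (auto simp: blocks_def K_def)
    then have "finite K"
      using b downward_closed_subset[OF dc x] infinite_blocks by blast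
    then obtain m where "\<And>n. n \<in> K \<Longrightarrow> n < m"
      unfolding finite_nat_set_iff_bounded by blast
    then have "char_fun x \<in> A m" by (fastforce simp: A_def K_def char_fun_def)
    then show "char_fun x \<in> (\<Union>m. A m)" by blast
  qed
  moreover have "meager (\<Union>m. A m)"
  proof -
    have "nowhere_dense (A m)" for m
      unfolding A_def using b(1) by (rule nowhere_dense_no_late_block)
    then show ?thesis unfolding meager_def by blast
  qed
  ultimately show False using nm meager_subset by blast
qed

section \<open>The filter of non-meager downward-closed families\<close>

lemma nonmeager_downsets_eq: "nonmeager_downsets = {X. groupwise_dense X}"
  using groupwise_dense_imp_not_meager not_meager_imp_groupwise_dense
    groupwise_dense_downward_closed
  unfolding nonmeager_downsets_def meager_downsets_def downset_lattice_def by blast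

lemma groupwise_dense_infinite_sets: "groupwise_dense infinite_sets"
  unfolding groupwise_dense_iff_blocks
proof (intro conjI allI impI)
  show "downward_closed infinite_sets" by (simp add: downward_closed_def)
  fix b :: "nat \<Rightarrow> nat" assume "strict_mono b"
  then show "\<exists>K. infinite K \<and> blocks b K \<in> infinite_sets"
    using infinite_blocks infinite_UNIV_nat by (auto simp: infinite_sets_def)
qed

text \<open>Upward closure is read off from meagerness, binary meets from groupwise density; the
  empty family shows properness.\<close>

lemma lattice_filter_nonmeager_downsets: "lattice_filter downset_lattice nonmeager_downsets"
  unfolding lattice_filter_def
proof (intro conjI ballI impI)
  show "nonmeager_downsets \<subseteq> downset_lattice" by (auto simp: nonmeager_downsets_def)
  show "nonmeager_downsets \<noteq> {}"
    using groupwise_dense_infinite_sets by (auto simp: nonmeager_downsets_eq)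
  have "{} \<in> downset_lattice" by (simp add: downset_lattice_def downward_closed_def)
  moreover have "\<not> groupwise_dense {}"
    using strict_mono_id by (auto simp: groupwise_dense_iff_blocks)
  ultimately show "nonmeager_downsets \<noteq> downset_lattice"
    by (auto simp: nonmeager_downsets_eq)
next
  fix X Y assume "X \<in> nonmeager_downsets" "Y \<in> downset_lattice" "X \<subseteq> Y"
  then show "Y \<in> nonmeager_downsets"
    using meager_subset[OF _ image_mono]
    by (auto simp: nonmeager_downsets_def meager_downsets_def)
next
  fix X Y assume "X \<in> nonmeager_downsets" "Y \<in> nonmeager_downsets"
  then show "X \<inter> Y \<in> nonmeager_downsets"
    by (simp add: nonmeager_downsets_eq groupwise_dense_Int)
qed

theorem theorem2:
  shows "(\<forall>\<G> :: nat set set set. (\<forall>G\<in>\<G>. groupwise_dense G) \<longrightarrow> |\<G>| <o groupwise_density_number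
            \<longrightarrow> groupwise_dense (family_Inter \<G>)) \<and>
         lattice_filter downset_lattice nonmeager_downsets \<and>
         less_complete groupwise_density_number nonmeager_downsets"
proof (intro conjI allI impI)
  show "groupwise_dense (family_Inter \<G>)"
    if "\<forall>G\<in>\<G>. groupwise_dense G" "|\<G>| <o groupwise_density_number" for \<G>
    using that by (rule groupwise_dense_family_Inter)
  show "lattice_filter downset_lattice nonmeager_downsets"
    by (rule lattice_filter_nonmeager_downsets)
  show "less_complete groupwise_density_number nonmeager_downsets"
    unfolding less_complete_def nonmeager_downsets_eq
    using groupwise_dense_family_Inter by blast
qed

end
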